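(* Let $K_{m,n}$ be a complete bipartite graph with $m,n\geq 2$. Then for any edge $e$, the eigenvalues of the eccentricity matrix $\varepsilon(K_{m,n}-e)$ are $-2$ with multiplicity $m+n-4$, together with the roots of the polynomial $$p(x) = x^4-2(m+n-4)x^3 + [4mn-12(m+n) + 15]x^2 + [16mn - 6(m+n) -40]x - 4[5mn-14(m+n)+32].$$
   Context: All graphs are finite, simple and connected. For a connected graph $G$, $d_G(u,v)$ is the length of a shortest $u$–$v$ path, and the eccentricity of a vertex $u$ is $e(u)=\max\{d_G(u,v): v\in V(G)\}$. The eccentricity matrix $\varepsilon(G)$ is the $|V(G)|\times|V(G)|$ matrix indexed by $V(G)$ with $\varepsilon(G)_{uv}=d_G(u,v)$ if $d_G(u,v)=\min\{e(u),e(v)\}$ and $\varepsilon(G)_{uv}=0$ otherwise. $G-e$ denotes the graph obtained from $G$ by deleting the edge $e$ (keeping all vertices). *)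

theory Defs
  imports
    "Graph_Theory.Graph_Theory"
    "Jordan_Normal_Form.Spectral_Radius"
begin

text \<open>
  Finite simple graphs are the locale \<^locale>\<open>graph\<close>: an undirected edge is a pair of mutually
  reverse arcs.
\<close>

text \<open>Deleting an undirected edge therefore removes both arcs with the end points of \<open>e\<close>.\<close>

definition del_edge :: "('a, 'b) pre_digraph \<Rightarrow> 'b \<Rightarrow> ('a, 'b) pre_digraph" where
  "del_edge G e =
     G\<lparr>arcs := {a \<in> arcs G. {tail G a, head G a} \<noteq> {tail G e, head G e}}\<rparr>"

text \<open>
  The distance is only meaningful if some path joins \<open>u\<close> and \<open>v\<close>, in particular in connected graphs.
\<close>

definition gdist :: "('a, 'b) pre_digraph \<Rightarrow> 'a \<Rightarrow> 'a \<Rightarrow> nat" where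
  "gdist G u v = (LEAST k. \<exists>p. pre_digraph.apath G u p v \<and> length p = k)"

definition eccentricity :: "('a, 'b) pre_digraph \<Rightarrow> 'a \<Rightarrow> nat" where
  "eccentricity G u = Max {gdist G u v |v. v \<in> verts G}"

definition ecc_entry :: "('a, 'b) pre_digraph \<Rightarrow> 'a \<Rightarrow> 'a \<Rightarrow> nat" where
  "ecc_entry G u v =
     (if gdist G u v = min (eccentricity G u) (eccentricity G v) then gdist G u v else 0)"

text \<open>
  Matrices are indexed by numbers, so the eccentricity matrix is taken with respect to an
  enumeration \<open>vs\<close> of the vertices without repetitions.  Its entries are regarded as complex
  numbers so that all roots of the characteristic polynomial are present.
\<close>

definition ecc_mat :: "('a, 'b) pre_digraph \<Rightarrow> 'a list \<Rightarrow> complex mat" where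
  "ecc_mat G vs =
     mat (length vs) (length vs) (\<lambda>(i, j). of_nat (ecc_entry G (vs ! i) (vs ! j)))"

text \<open>The multiset of eigenvalues, each with its algebraic multiplicity.\<close>

definition eigenvalue_mset :: "'a :: field mat \<Rightarrow> 'a multiset" where
  "eigenvalue_mset A = (\<Sum>k\<in>spectrum A. replicate_mset (order k (char_poly A)) k)"

lemma eigenvalue_mset_eq_proots:
  fixes A :: "'a :: field mat"
  assumes A: "A \<in> carrier_mat n n"
  shows "eigenvalue_mset A = proots (char_poly A)"
proof (rule multiset_eqI)
  fix x
  have nz: "char_poly A \<noteq> 0"
    using degree_monic_char_poly[OF A] by auto
  have fin: "finite (spectrum A)"
    using card_finite_spectrum[OF A] by simp
  have "count (eigenvalue_mset A) x =
      (\<Sum>k\<in>spectrum A. if x = k then order k (char_poly A) else 0)"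
    unfolding eigenvalue_mset_def by (simp add: count_sum)
  also have "\<dots> = (if x \<in> spectrum A then order x (char_poly A) else 0)"
    using fin by simp
  also have "\<dots> = order x (char_poly A)"
    using nz by (simp add: spectrum_root_char_poly[OF A] order_root)
  finally show "count (eigenvalue_mset A) x = count (proots (char_poly A)) x"
    using nz by simp
qed

end

theory Submission
  imports
    Defs
    "HOL-Library.Indicator_Function"
begin

text \<open>
  Let \<open>u v\<close> be the deleted edge, \<open>u\<close> in the part \<open>U\<close> and \<open>v\<close> in the part \<open>V\<close>. Adding \<open>2\<close> to the
  diagonal of the eccentricity matrix turns it into
  \<open>2 1\<^sub>U 1\<^sub>U\<^sup>T + 2 1\<^sub>V 1\<^sub>V\<^sup>T + 3 (e\<^sub>u e\<^sub>v\<^sup>T + e\<^sub>v e\<^sub>u\<^sup>T)\<close>, a product \<open>X Y\<close> of an \<open>(m + n) \<times> 4\<close> and a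
  \<open>4 \<times> (m + n)\<close> matrix. By the Weinstein--Aronszajn identity its characteristic polynomial is, up to a
  power of the variable, that of the \<open>4 \<times> 4\<close> matrix \<open>Y X\<close>, which yields the quartic; the quartic does
  not vanish at \<open>-2\<close>, since its value there is \<open>-36 (m - 1) (n - 1)\<close>.
\<close>

section \<open>Determinants\<close>

text \<open>The block matrix \<open>M\<close> is reduced to block triangular form twice:
  \<open>R\<close> on the right leaves \<open>y I - X Y\<close>, \<open>L\<close> on the left leaves
  \<open>y I - Y X\<close>. Since \<open>L\<close> has determinant \<open>y ^ k\<close>, no division
  by \<open>y\<close> occurs and \<open>y = 0\<close> is covered.\<close>

lemma det_weinstein_aronszajn:
  fixes X :: "'a :: idom mat"
  assumes X: "X \<in> carrier_mat n k" and Y: "Y \<in> carrier_mat k n"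
  shows "y ^ k * det (y \<cdot>\<^sub>m 1\<^sub>m n - X * Y) = y ^ n * det (y \<cdot>\<^sub>m 1\<^sub>m k - Y * X)"
proof -
  define M where "M = four_block_mat (y \<cdot>\<^sub>m 1\<^sub>m n) X Y (1\<^sub>m k)"
  define R where "R = four_block_mat (1\<^sub>m n) (0\<^sub>m n k) (- Y) (1\<^sub>m k)"
  define L where "L = four_block_mat (1\<^sub>m n) (0\<^sub>m n k) (- Y) (y \<cdot>\<^sub>m 1\<^sub>m k)"
  have carr: "M \<in> carrier_mat (n + k) (n + k)" "R \<in> carrier_mat (n + k) (n + k)"
    "L \<in> carrier_mat (n + k) (n + k)"
    by (simp_all add: M_def R_def L_def)
  have dR: "det R = 1" and dL: "det L = y ^ k"
    unfolding R_def L_def using Y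
    by (subst det_four_block_mat_upper_right_zero[of _ n _ k]; auto)+
  have "M * R = four_block_mat (y \<cdot>\<^sub>m 1\<^sub>m n - X * Y) X (0\<^sub>m k n) (1\<^sub>m k)"
    unfolding M_def R_def using X Y
    by (subst mult_four_block_mat[of _ n n _ k _ k _ _ n _ k]) (auto simp: minus_add_uminus_mat)
  then have "det (M * R) = det (y \<cdot>\<^sub>m 1\<^sub>m n - X * Y)"
    using X Y
    by (simp add: det_four_block_mat_lower_left_zero[of _ n _ k] minus_carrier_mat
        mult_carrier_mat[OF X Y] mult_carrier_mat[OF Y X])
  then have 1: "det M = det (y \<cdot>\<^sub>m 1\<^sub>m n - X * Y)"
    using det_mult[OF carr(1,2)] dR by simp
  have "L * M = four_block_mat (y \<cdot>\<^sub>m 1\<^sub>m n) X (0\<^sub>m k n) (y \<cdot>\<^sub>m 1\<^sub>m k - Y * X)"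
    unfolding M_def L_def using X Y
    by (subst mult_four_block_mat[of _ n n _ k _ k _ _ n _ k]) (auto simp: minus_add_uminus_mat)
  then have "det (L * M) = y ^ n * det (y \<cdot>\<^sub>m 1\<^sub>m k - Y * X)"
    using X Y
    by (simp add: det_four_block_mat_lower_left_zero[of _ n _ k] minus_carrier_mat
        mult_carrier_mat[OF X Y] mult_carrier_mat[OF Y X])
  then have "y ^ k * det M = y ^ n * det (y \<cdot>\<^sub>m 1\<^sub>m k - Y * X)"
    using det_mult[OF carr(3,1)] dL by simp
  with 1 show ?thesis by simp
qed

text \<open>Laplace expansion along the first row. The minor is again of the form
  \<open>mat n n\<close>, its column index skipping \<open>j\<close>, so that the rule can be
  iterated.\<close>

lemma det_mat_Suc:
  fixes f :: "nat \<times> nat \<Rightarrow> 'a :: comm_ring_1"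
  shows "det (mat (Suc n) (Suc n) f) =
    (\<Sum>j<Suc n. f (0, j) * ((- 1) ^ j *
      det (mat n n (\<lambda>(i, k). f (Suc i, if k < j then k else Suc k)))))"
proof -
  have "mat_delete (mat (Suc n) (Suc n) f) 0 j =
      mat n n (\<lambda>(i, k). f (Suc i, if k < j then k else Suc k))" if "j < Suc n" for j
    using that by (intro eq_matI) (auto simp: mat_delete_def)
  then show ?thesis
    by (subst laplace_expansion_row[of _ "Suc n" 0]) (auto simp: cofactor_def)
qed

lemma det_mat_2:
  fixes f :: "nat \<times> nat \<Rightarrow> 'a :: comm_ring_1"
  shows "det (mat 2 2 f) = f (0, 0) * f (1, 1) - f (0, 1) * f (1, 0)"
  using det_mat_Suc[of 1 f] by (simp add: numeral_2_eq_2 det_single)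

lemma det_mat_3:
  fixes f :: "nat \<times> nat \<Rightarrow> 'a :: comm_ring_1"
  shows "det (mat 3 3 f) =
    f (0, 0) * (f (1, 1) * f (2, 2) - f (1, 2) * f (2, 1)) -
    f (0, 1) * (f (1, 0) * f (2, 2) - f (1, 2) * f (2, 0)) +
    f (0, 2) * (f (1, 0) * f (2, 1) - f (1, 1) * f (2, 0))"
proof -
  have *: "Suc (Suc 0) = 2" "Suc 2 = 3" "{..<3} = {0, 1, 2 :: nat}" by auto
  show ?thesis
    using det_mat_Suc[of 2 f] unfolding * by (simp add: det_mat_2 * algebra_simps)
qed

lemma det_mat_4:
  fixes f :: "nat \<times> nat \<Rightarrow> 'a :: comm_ring_1"
  shows "det (mat 4 4 f) =
    (\<Sum>j<4. (- 1) ^ j * f (0, j) * det (mat 3 3 (\<lambda>(i, k). f (Suc i, if k < j then k else Suc k))))"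
  using det_mat_Suc[of 3 f] by (simp add: ac_simps)

section \<open>Distances\<close>

lemma (in wf_digraph) gdist_eq_0:
  assumes "x \<in> verts G"
  shows "gdist G x x = 0"
  unfolding gdist_def using assms
  by (intro Least_equality) (auto intro!: exI[of _ "[]"] simp: apath_simps)

lemma (in wf_digraph) gdist_eq_1:
  assumes "x \<noteq> y" "x \<rightarrow>\<^bsub>G\<^esub> y"
  shows "gdist G x y = 1"
  unfolding gdist_def
proof (rule Least_equality)
  obtain a where "a \<in> arcs G" "tail G a = x" "head G a = y"
    using assms(2) by (auto simp: arcs_ends_def arc_to_ends_def)
  then show "\<exists>p. apath x p y \<and> length p = 1"
    using assms(1) by (auto intro!: exI[of _ "[a]"] simp: apath_simps)
next
  fix k assume "\<exists>p. apath x p y \<and> length p = k"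
  then show "1 \<le> k" using assms(1) by (cases k) (auto simp: apath_simps)
qed

lemma (in wf_digraph) apath_length_ge_2:
  assumes "x \<noteq> y" "\<not> x \<rightarrow>\<^bsub>G\<^esub> y" "apath x p y"
  shows "2 \<le> length p"
\<comment> \<open>The rule serves only to split lists into empty, singleton and longer ones.\<close>
proof (cases p rule: remdups_adj.cases)
  case (2 a)
  then show ?thesis
    using assms by (auto simp: apath_simps arcs_ends_def arc_to_ends_def)
qed (use assms in \<open>auto simp: apath_simps\<close>)

lemma (in wf_digraph) gdist_eq_2:
  assumes "x \<noteq> y" "\<not> x \<rightarrow>\<^bsub>G\<^esub> y" "x \<rightarrow>\<^bsub>G\<^esub> w" "w \<rightarrow>\<^bsub>G\<^esub> y" "x \<noteq> w" "w \<noteq> y"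
  shows "gdist G x y = 2"
  unfolding gdist_def
proof (rule Least_equality)
  obtain a where a: "a \<in> arcs G" "tail G a = x" "head G a = w"
    using assms(3) by (auto simp: arcs_ends_def arc_to_ends_def)
  obtain b where b: "b \<in> arcs G" "tail G b = w" "head G b = y"
    using assms(4) by (auto simp: arcs_ends_def arc_to_ends_def)
  show "\<exists>p. apath x p y \<and> length p = 2"
    using assms a b by (auto intro!: exI[of _ "[a, b]"] simp: apath_simps)
qed (use assms apath_length_ge_2 in blast)

lemma (in wf_digraph) gdist_eq_3:
  assumes "distinct [x, w, z, y]" "x \<rightarrow>\<^bsub>G\<^esub> w" "w \<rightarrow>\<^bsub>G\<^esub> z" "z \<rightarrow>\<^bsub>G\<^esub> y"
    and "\<not> x \<rightarrow>\<^bsub>G\<^esub> y" "\<And>t. x \<rightarrow>\<^bsub>G\<^esub> t \<Longrightarrow> \<not> t \<rightarrow>\<^bsub>G\<^esub> y"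
  shows "gdist G x y = 3"
  unfolding gdist_def
proof (rule Least_equality)
  obtain a where a: "a \<in> arcs G" "tail G a = x" "head G a = w"
    using assms(2) by (auto simp: arcs_ends_def arc_to_ends_def)
  obtain b where b: "b \<in> arcs G" "tail G b = w" "head G b = z"
    using assms(3) by (auto simp: arcs_ends_def arc_to_ends_def)
  obtain c where c: "c \<in> arcs G" "tail G c = z" "head G c = y"
    using assms(4) by (auto simp: arcs_ends_def arc_to_ends_def)
  show "\<exists>p. apath x p y \<and> length p = 3"
    using assms(1) a b c by (auto intro!: exI[of _ "[a, b, c]"] simp: apath_simps)
next
  fix k assume "\<exists>p. apath x p y \<and> length p = k"
  then obtain p where p: "apath x p y" "length p = k" by blast
  have "2 \<le> k" using apath_length_ge_2[of x y p] assms(1,5) p by auto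
  moreover have "k \<noteq> 2"
  proof
    assume "k = 2"
    then obtain a b where "p = [a, b]"
      using p(2) by (auto simp: length_Suc_conv numeral_2_eq_2)
    then have "a \<in> arcs G" "b \<in> arcs G" "tail G a = x" "tail G b = head G a" "head G b = y"
      using p(1) by (auto simp: apath_simps)
    then have "x \<rightarrow>\<^bsub>G\<^esub> head G a" "head G a \<rightarrow>\<^bsub>G\<^esub> y"
      by (metis in_arcs_imp_in_arcs_ends)+
    with assms(6) show False by blast
  qed
  ultimately show "3 \<le> k" by simp
qed

section \<open>The complete bipartite graph without the edge \<open>u v\<close>\<close>

locale biclique_minus_edge = wf_digraph H
  for H :: "('a, 'b) pre_digraph" +
  fixes U V :: "'a set" and u v :: 'a
  assumes verts_eq: "verts H = U \<union> V"
    and disj: "U \<inter> V = {}"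
    and u: "u \<in> U" and v: "v \<in> V"
    and card_U: "2 \<le> card U" and card_V: "2 \<le> card V"
    and ends: "arcs_ends H = U \<times> V \<union> V \<times> U - {(u, v), (v, u)}"
begin

text \<open>The locale is symmetric in the two parts, so each fact about vertices of
  \<open>U\<close> also yields its counterpart for \<open>V\<close>.\<close>

lemma swapped: "biclique_minus_edge H V U v u"
  using verts_eq disj u v card_U card_V ends by unfold_locales auto

lemma finite_parts: "finite U" "finite V"
  using card_U card_V by (auto intro: card_ge_0_finite)

lemma other_vertices:
  obtains u' v' where "u' \<in> U" "u' \<noteq> u" "v' \<in> V" "v' \<noteq> v"
proof -
  have "\<not> U \<subseteq> {u}" "\<not> V \<subseteq> {v}"
    using card_mono[of "{u}" U] card_mono[of "{v}" V] card_U card_V by auto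
  then show thesis using that by blast
qed

lemma gdist_left:
  assumes x: "x \<in> U" and y: "y \<in> U \<union> V"
  shows "gdist H x y =
    (if x = y then 0 else if y \<in> U then 2 else if x = u \<and> y = v then 3 else 1)"
proof -
  obtain u' v' where w: "u' \<in> U" "u' \<noteq> u" "v' \<in> V" "v' \<noteq> v"
    by (rule other_vertices)
  consider "x = y" | "x \<noteq> y" "y \<in> U" | "x = u" "y = v" | "y \<in> V" "x \<noteq> u \<or> y \<noteq> v"
    using y by blast
  then show ?thesis
  proof cases
    case 1
    then show ?thesis using gdist_eq_0[of x] x verts_eq by simp
  next
    case 2
    \<comment> \<open>As \<open>v'\<close> differs from \<open>v\<close>, it is adjacent to all of
      \<open>U\<close>, including \<open>u\<close>.\<close>
    then have "gdist H x y = 2"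
      using w x disj u v by (intro gdist_eq_2[of x y v']) (auto simp: ends)
    with 2 show ?thesis by simp
  next
    case 3
    \<comment> \<open>The detour is \<open>u\<close>, \<open>v'\<close>, \<open>u'\<close>,
      \<open>v\<close>. Two steps do not suffice: neighbours of \<open>u\<close> lie in
      \<open>V\<close>, and none of these is adjacent to \<open>v\<close>.\<close>
    have "gdist H u v = 3"
      using w u v disj by (intro gdist_eq_3[of u v' u' v]) (auto simp: ends)
    with 3 show ?thesis using disj u v by auto
  next
    case 4
    then have "gdist H x y = 1"
      using x disj u v by (intro gdist_eq_1) (auto simp: ends)
    with 4 show ?thesis using x disj by auto
  qed
qed

lemma eccentricity_left:
  assumes x: "x \<in> U"
  shows "eccentricity H x = (if x = u then 3 else 2)"
  unfolding eccentricity_def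
proof (rule Max_eqI)
  have *: "{gdist H x y |y. y \<in> verts H} = gdist H x ` verts H" by auto
  show "finite {gdist H x y |y. y \<in> verts H}"
    unfolding * using finite_parts by (simp add: verts_eq)
  show "(if x = u then 3 else 2) \<in> {gdist H x y |y. y \<in> verts H}"
  proof (cases "x = u")
    case True
    then have "gdist H x v = 3" using gdist_left[OF x, of v] disj u v by auto
    with True v show ?thesis by (auto simp: verts_eq intro!: exI[of _ v])
  next
    case False
    then have "gdist H x u = 2" using gdist_left[OF x, of u] u by auto
    with False u show ?thesis by (auto simp: verts_eq intro!: exI[of _ u])
  qed
next
  fix d assume "d \<in> {gdist H x y |y. y \<in> verts H}"
  then show "d \<le> (if x = u then 3 else 2)"
    using gdist_left[OF x] by (auto simp: verts_eq)
qed

lemmas gdist_right = biclique_minus_edge.gdist_left[OF swapped]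
lemmas eccentricity_right = biclique_minus_edge.eccentricity_left[OF swapped]

text \<open>Of two distinct vertices of \<open>U\<close> at most one has eccentricity 3, so their
  distance 2 is the minimum and survives. Across the parts distance 1 is below every eccentricity;
  only for \<open>u\<close> and \<open>v\<close> do distance and both eccentricities equal
  3.\<close>

lemma ecc_entry_left:
  assumes x: "x \<in> U" and y: "y \<in> U \<union> V"
  shows "ecc_entry H x y =
    (if y \<in> U then if x = y then 0 else 2 else if x = u \<and> y = v then 3 else 0)"
proof (cases "y \<in> U")
  case True
  then show ?thesis
    using x y u by (simp add: ecc_entry_def gdist_left eccentricity_left)
next
  case False
  then have "y \<in> V" using y by blast
  moreover have "x \<noteq> y" using False x by blast
  ultimately show ?thesis
    using False x u gdist_left[OF u, of v]
    by (auto simp: ecc_entry_def gdist_left eccentricity_left eccentricity_right)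
qed

lemmas ecc_entry_right = biclique_minus_edge.ecc_entry_left[OF swapped]

text \<open>The summand \<open>2 * of_bool (x = y)\<close> fills the zero diagonal, so each part
  becomes a constant block. What results is a sum of four products of a function of \<open>x\<close>
  and a function of \<open>y\<close>, that is, of four rank-one matrices.\<close>

lemma ecc_entry_eq:
  assumes "x \<in> U \<union> V" "y \<in> U \<union> V"
  shows "of_nat (ecc_entry H x y) + 2 * of_bool (x = y) =
    (2 * (indicator U x * indicator U y) + 2 * (indicator V x * indicator V y) +
     3 * (indicator {u} x * indicator {v} y) + 3 * (indicator {v} x * indicator {u} y)
       :: 'c :: comm_ring_1)"
proof -
  have ind: "indicator {a} b = (of_bool (b = a) :: 'c)" for a b :: 'a
    by (simp add: indicator_def)
  consider "x \<in> U" "x \<notin> V" "x \<noteq> v" | "x \<in> V" "x \<notin> U" "x \<noteq> u"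
    using assms(1) disj u v by blast
  then show ?thesis
  proof cases
    case 1
    consider "y \<in> U" "y \<notin> V" "y \<noteq> v" | "y \<in> V" "y \<notin> U" "y \<noteq> u" "x \<noteq> y"
      using assms(2) 1 disj u v by blast
    then show ?thesis
      using 1 by cases (simp_all add: ecc_entry_left ind)
  next
    case 2
    consider "y \<in> V" "y \<notin> U" "y \<noteq> u" | "y \<in> U" "y \<notin> V" "y \<noteq> v" "x \<noteq> y"
      using assms(2) 2 disj u v by blast
    then show ?thesis
      using 2 by cases (simp_all add: ecc_entry_right ind)
  qed
qed

section \<open>Spectrum\<close>

text \<open>Its value at \<open>x\<close> is that of the characteristic polynomial of the 4 by 4
  matrix \<open>Y * X\<close> at \<open>x + 2\<close>.\<close>

definition quartic :: "complex poly" where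
  "quartic = (let M = of_nat (card U); N = of_nat (card V) in
     [: - 4 * (5 * M * N - 14 * (M + N) + 32),
        16 * M * N - 6 * (M + N) - 40,
        4 * M * N - 12 * (M + N) + 15,
        - 2 * (M + N - 4),
        1 :])"

lemma char_poly_ecc_mat:
  assumes vs: "distinct vs" "set vs = verts H"
  shows "char_poly (ecc_mat H vs) = [:2, 1:] ^ (card U + card V - 4) * quartic"
proof -
  define N where "N = length vs"
  define A where "A = ecc_mat H vs"
  \<comment> \<open>\<open>S\<close> and \<open>T\<close> list the left and right factors of the
    four rank-one terms. They differ in the order of \<open>{u}\<close> and \<open>{v}\<close>,
    because the entry 3 sits at the positions of the pair \<open>u\<close>,
    \<open>v\<close>.\<close>
  define S where "S k = (if k = 0 then U else if k = 1 then V else if k = 2 then {u} else {v})"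
    for k :: nat
  define T where "T k = (if k = 0 then U else if k = 1 then V else if k = 2 then {v} else {u})"
    for k :: nat
  define c :: "nat \<Rightarrow> complex" where "c k = (if k < 2 then 2 else 3)" for k
  define X :: "complex mat" where "X = mat N 4 (\<lambda>(i, k). indicator (S k) (vs ! i))"
  define Y :: "complex mat" where "Y = mat 4 N (\<lambda>(k, j). c k * indicator (T k) (vs ! j))"
  have N: "N = card U + card V"
    using vs finite_parts disj
    by (metis N_def distinct_card verts_eq card_Un_disjoint)
  have carr: "A \<in> carrier_mat N N" "X \<in> carrier_mat N 4" "Y \<in> carrier_mat 4 N"
    by (auto simp: A_def ecc_mat_def N_def X_def Y_def)
  have in_UV: "vs ! i \<in> U \<union> V" if "i < N" for i
    using that vs(2) verts_eq nth_mem N_def by blast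
  have less4: "{..<4} = {0, 1, 2, 3 :: nat}" by auto
  have XY: "X * Y = A + 2 \<cdot>\<^sub>m 1\<^sub>m N"
  proof (rule eq_matI)
    fix i j assume "i < dim_row (A + 2 \<cdot>\<^sub>m 1\<^sub>m N)" "j < dim_col (A + 2 \<cdot>\<^sub>m 1\<^sub>m N)"
    then have ij: "i < N" "j < N" by auto
    have eq: "vs ! i = vs ! j \<longleftrightarrow> i = j"
      using ij vs(1) by (simp add: N_def nth_eq_iff_index_eq)
    have "(X * Y) $$ (i, j) = (\<Sum>k<4. X $$ (i, k) * Y $$ (k, j))"
      using ij carr by (simp add: scalar_prod_def atLeast0LessThan)
    also have "\<dots> = of_nat (ecc_entry H (vs ! i) (vs ! j)) + 2 * of_bool (vs ! i = vs ! j)"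
      using ij
      by (simp add: ecc_entry_eq[OF in_UV in_UV] less4 X_def Y_def S_def T_def c_def
          mult.left_commute del: indicator_simps split del: if_split)
    also have "\<dots> = (A + 2 \<cdot>\<^sub>m 1\<^sub>m N) $$ (i, j)"
      using ij by (simp add: A_def ecc_mat_def N_def eq)
    finally show "(X * Y) $$ (i, j) = (A + 2 \<cdot>\<^sub>m 1\<^sub>m N) $$ (i, j)" .
  qed (use carr in auto)
  have S_sub: "S k \<subseteq> U \<union> V" "finite (S k)" for k
    using u v finite_parts by (auto simp: S_def)
  have bij: "bij_betw ((!) vs) {..<N} (U \<union> V)"
    using vs by (intro bij_betw_nth) (auto simp: N_def verts_eq)
  \<comment> \<open>Summing a product of two indicators over all vertices counts an intersection, so
    the enumeration \<open>vs\<close> drops out.\<close>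
  have YX: "Y * X = mat 4 4 (\<lambda>(k, l). c k * of_nat (card (T k \<inter> S l)))"
  proof (rule eq_matI, goal_cases)
    case (1 k l)
    then have kl: "k < 4" "l < 4" by auto
    have "(Y * X) $$ (k, l) = (\<Sum>i<N. Y $$ (k, i) * X $$ (i, l))"
      using kl carr by (simp add: scalar_prod_def atLeast0LessThan)
    also have "\<dots> = (\<Sum>i<N. c k * (indicator (T k) (vs ! i) * indicator (S l) (vs ! i)))"
      using kl by (simp add: X_def Y_def mult.assoc)
    also have "\<dots> = (\<Sum>x\<in>U \<union> V. c k * (indicator (T k) x * indicator (S l) x))"
      by (rule sum.reindex_bij_betw[OF bij])
    also have "\<dots> = c k * of_nat (card ((U \<union> V) \<inter> (T k \<inter> S l)))"
      using sum_mult_indicator[of "U \<union> V" "\<lambda>_. 1 :: complex" "T k \<inter> S l"] finite_parts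
      by (simp add: indicator_inter_arith flip: sum_distrib_left)
    also have "(U \<union> V) \<inter> (T k \<inter> S l) = T k \<inter> S l"
      using S_sub by blast
    finally show ?case using kl by simp
  qed (use carr in auto)
  have disj': "V \<inter> U = {}" "u \<notin> V" "v \<notin> U" "u \<noteq> v" "v \<noteq> u"
    using disj u v by auto
  have det4: "det ((x + 2) \<cdot>\<^sub>m 1\<^sub>m 4 - Y * X) = poly quartic x" for x
  proof -
    define f where
      "f = (\<lambda>(k, l). (if k = l then x + 2 else 0) - c k * of_nat (card (T k \<inter> S l)))"
    have f: "f (0, 0) = x + 2 - 2 * of_nat (card U)" "f (0, 1) = 0" "f (0, 2) = - 2" "f (0, 3) = 0"
      "f (1, 0) = 0" "f (1, 1) = x + 2 - 2 * of_nat (card V)" "f (1, 2) = 0" "f (1, 3) = - 2"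
      "f (2, 0) = 0" "f (2, 1) = - 3" "f (2, 2) = x + 2" "f (2, 3) = - 3"
      "f (3, 0) = - 3" "f (3, 1) = 0" "f (3, 2) = - 3" "f (3, 3) = x + 2"
      using disj disj' u v by (simp_all add: f_def c_def T_def S_def)
    have mat: "(x + 2) \<cdot>\<^sub>m 1\<^sub>m 4 - Y * X = mat 4 4 f"
      unfolding YX f_def by (intro eq_matI) simp_all
    have Suc: "Suc (Suc 0) = 2" "Suc 2 = 3" by auto
    show ?thesis
      by (simp add: mat det_mat_4 det_mat_3 less4 Suc f f[unfolded One_nat_def] quartic_def Let_def)
        (simp add: algebra_simps)
  qed
  have "[:2, 1:] ^ 4 * char_poly A = [:2, 1:] ^ N * quartic"
  \<comment> \<open>Over the complex numbers, polynomials with equal values everywhere are equal;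
    the determinant identity may thus be applied pointwise.\<close>
  proof (intro poly_eq_poly_eq_iff[THEN iffD1] ext)
    fix x
    have "- char_matrix A x = (x + 2) \<cdot>\<^sub>m 1\<^sub>m N - X * Y"
      unfolding XY using carr by (intro eq_matI) (auto simp: char_matrix_def)
    then have "(x + 2) ^ 4 * poly (char_poly A) x = (x + 2) ^ N * poly quartic x"
      using det_weinstein_aronszajn[OF carr(2,3), of "x + 2"] det4[of x]
      unfolding char_poly_matrix[OF carr(1)] by simp
    then show "poly ([:2, 1:] ^ 4 * char_poly A) x = poly ([:2, 1:] ^ N * quartic) x"
      by (simp add: poly_power add.commute)
  qed
  \<comment> \<open>Both parts have at least two vertices, so the subtraction is not truncated and
    the fourth power can be cancelled.\<close>
  also have "N = 4 + (N - 4)"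
    using card_U card_V N by simp
  finally have "[:2, 1:] ^ 4 * char_poly A = [:2, 1:] ^ 4 * ([:2, 1:] ^ (N - 4) * quartic)"
    by (simp only: power_add mult.assoc)
  then have "char_poly A = [:2, 1:] ^ (N - 4) * quartic"
    by (subst (asm) mult_left_cancel) auto
  then show ?thesis
    by (simp only: A_def N)
qed

text \<open>The first claim reads off the roots of the factored characteristic polynomial; the
  second ensures that the quartic contributes no further copies of \<open>-2\<close>.\<close>

lemma eigenvalue_mset_ecc_mat:
  assumes "distinct vs" "set vs = verts H"
  defines "E \<equiv> eigenvalue_mset (ecc_mat H vs)"
  shows "E = replicate_mset (card U + card V - 4) (- 2) + proots quartic"
    and "count E (- 2) = card U + card V - 4"
proof -
  have nz: "quartic \<noteq> 0" by (simp add: quartic_def Let_def)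
  have "ecc_mat H vs \<in> carrier_mat (length vs) (length vs)"
    by (simp add: ecc_mat_def)
  then show E: "E = replicate_mset (card U + card V - 4) (- 2) + proots quartic"
    unfolding E_def using nz
    by (simp add: eigenvalue_mset_eq_proots char_poly_ecc_mat assms(1,2) proots_mult proots_power)
  have "poly quartic (- 2) = - 36 * (of_nat (card U) - 1) * (of_nat (card V) - 1)"
    by (simp add: quartic_def Let_def algebra_simps)
  also have "\<dots> \<noteq> 0"
    using card_U card_V by auto
  finally have "order (- 2) quartic = 0"
    by (rule order_0I)
  then show "count E (- 2) = card U + card V - 4"
    using nz by (simp add: E)
qed

end

section \<open>Transfer to an arbitrary edge of a complete bipartite graph\<close>

lemma biclique_minus_edge_del_edge:
  assumes "graph G" "verts G = U \<union> V" "U \<inter> V = {}" "2 \<le> card U" "2 \<le> card V"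
    and ends: "arcs_ends G = U \<times> V \<union> V \<times> U"
    and "tail G e \<in> U" "head G e \<in> V"
  shows "biclique_minus_edge (del_edge G e) U V (tail G e) (head G e)"
proof -
  interpret graph G by fact
  \<comment> \<open>An unordered pair of end points arises from exactly these two
    orientations.\<close>
  have "arcs_ends (del_edge G e) = arcs_ends G - {(tail G e, head G e), (head G e, tail G e)}"
    unfolding del_edge_def arcs_ends_def arc_to_ends_def
    by (auto simp: doubleton_eq_iff)
  moreover have "wf_digraph (del_edge G e)"
    by unfold_locales (simp_all add: del_edge_def)
  ultimately show ?thesis
    using assms
    by (simp add: biclique_minus_edge_def biclique_minus_edge_axioms_def del_edge_def)
qed

theorem theorem2p7:
  fixes G :: "('a, 'b) pre_digraph" and m n :: nat and e :: 'b and vs :: "'a list"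
  assumes "m \<ge> 2" and "n \<ge> 2" and "K\<^bsub>m,n\<^esub> G" and "e \<in> arcs G"
    and "distinct vs" and "set vs = verts (del_edge G e)"
  shows "(let M = of_nat m :: complex; N = of_nat n :: complex;
              p = [: - 4 * (5 * M * N - 14 * (M + N) + 32),
                     16 * M * N - 6 * (M + N) - 40,
                     4 * M * N - 12 * (M + N) + 15,
                     - 2 * (M + N - 4),
                     1 :];
              E = eigenvalue_mset (ecc_mat (del_edge G e) vs)
          in E = replicate_mset (m + n - 4) (- 2) + proots p \<and>
             count E (- 2) = m + n - 4)"
proof -
  obtain U V where G: "graph G" "verts G = U \<union> V" "U \<inter> V = {}" "card U = m" "card V = n"
    and ends: "arcs_ends G = U \<times> V \<union> V \<times> U"
    using assms(3) by (auto simp: complete_bipartite_digraph_def)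
  have "(tail G e, head G e) \<in> arcs_ends G"
    using assms(4) by (auto simp: arcs_ends_def arc_to_ends_def)
  then consider "tail G e \<in> U" "head G e \<in> V" | "tail G e \<in> V" "head G e \<in> U"
    using ends by auto
  then show ?thesis
  proof cases
    case 1
    then interpret biclique_minus_edge "del_edge G e" U V "tail G e" "head G e"
      using assms(1,2) G ends by (intro biclique_minus_edge_del_edge) auto
    show ?thesis
      using eigenvalue_mset_ecc_mat[OF assms(5,6)] by (simp add: quartic_def Let_def G)
  next
    case 2
    \<comment> \<open>The arc runs from \<open>V\<close> to \<open>U\<close>, so the parts exchange
      roles; the quartic is symmetric in \<open>m\<close> and \<open>n\<close>.\<close>
    then interpret biclique_minus_edge "del_edge G e" V U "tail G e" "head G e"
      using assms(1,2) G ends by (intro biclique_minus_edge_del_edge) auto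
    show ?thesis
      using eigenvalue_mset_ecc_mat[OF assms(5,6)]
      by (simp add: quartic_def Let_def G ac_simps)
  qed
qed

end
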